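(* Let $M=\langle a,a+d,\ldots,a+kd\rangle$ be an arithmetic monoid. Then for all $m\in M$, $$c_{mon}(m)=c(m).$$ Consequently, $c_{mon}(M)=c(M)$.
   Context: $\mathbb N$ includes $0$. A numerical monoid is a cofinite additive submonoid $M$ of $\mathbb N$; when one writes $M=\langle n_0,\ldots,n_k\rangle$, the listed elements are its unique minimal generating set. An arithmetic monoid is a numerical monoid $M=\langle a,a+d,\ldots,a+kd\rangle$ with $a,k,d$ positive integers, these generators being the minimal generators (in particular $\gcd(a,d)=1$). For $m\in M$: $\mathcal Z(m)$ is the set of vectors $(z_0,\ldots,z_k)\in\mathbb N^{k+1}$ with $\sum_i z_i(a+id)=m$ (factorizations); the length is $|z|=\sum_i z_i$. For $z,z'\in\mathcal Z(m)$, $\gcd\{z,z'\}$ is the coordinatewise minimum and $d(z,z')=\max\{|z|,|z'|\}-|\gcd\{z,z'\}|$. An $N$-chain from $z$ to $z'$ is a finite sequence of factorizations of $m$ starting at $z$ and ending at $z'$ with consecutive distances $\le N$. The catenary degree $c(m)$ is the smallest $N\in\mathbb N$ such that any two factorizations of $m$ are connected by an $N$-chain. The monotone catenary degree $c_{mon}(m)$ is the smallest $N\in\mathbb N$ such that any two factorizations of $m$ are connected by an $N$-chain along which the lengths are either non-decreasing throughout or non-increasing throughout. Set-wise, $c(M)=\max\{c(m):m\in M\}$ and $c_{mon}(M)=\max\{c_{mon}(m):m\in M\}$. *)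

theory Defs
  imports Complex_Main
begin

section \<open>Arithmetic monoids\<close>

definition submonoid :: "nat set \<Rightarrow> bool" where
  "submonoid M \<longleftrightarrow> 0 \<in> M \<and> (\<forall>x\<in>M. \<forall>y\<in>M. x + y \<in> M)"

definition numerical_monoid :: "nat set \<Rightarrow> bool" where
  "numerical_monoid M \<longleftrightarrow> submonoid M \<and> finite (- M)"

definition minimal_generating_set :: "nat set \<Rightarrow> nat set \<Rightarrow> bool" where
  "minimal_generating_set S M \<longleftrightarrow>
     submonoid hull S = M \<and> (\<forall>T. T \<subset> S \<longrightarrow> submonoid hull T \<noteq> M)"

definition arithmetic_monoid :: "nat set \<Rightarrow> nat \<Rightarrow> nat \<Rightarrow> nat \<Rightarrow> bool" where
  "arithmetic_monoid M a d k \<longleftrightarrow>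
     0 < a \<and> 0 < d \<and> 0 < k \<and> numerical_monoid M \<and>
     minimal_generating_set {a + i * d |i. i \<le> k} M"


section \<open>Factorizations and catenary degrees\<close>

text \<open>A vector $(z_0,\ldots,z_k)$ of natural numbers is represented by a function
  \<open>z :: nat \<Rightarrow> nat\<close> that vanishes at all indices greater than \<open>k\<close>, so that distinct functions
  in \<open>factorizations a d k m\<close> are distinct vectors.\<close>

definition factorizations :: "nat \<Rightarrow> nat \<Rightarrow> nat \<Rightarrow> nat \<Rightarrow> (nat \<Rightarrow> nat) set" where
  "factorizations a d k m =
     {z. (\<forall>i>k. z i = 0) \<and> (\<Sum>i\<le>k. z i * (a + i * d)) = m}"

definition flength :: "nat \<Rightarrow> (nat \<Rightarrow> nat) \<Rightarrow> nat" where
  "flength k z = (\<Sum>i\<le>k. z i)"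

definition fgcd :: "(nat \<Rightarrow> nat) \<Rightarrow> (nat \<Rightarrow> nat) \<Rightarrow> nat \<Rightarrow> nat" where
  "fgcd z z' = (\<lambda>i. min (z i) (z' i))"

text \<open>The subtraction on natural numbers does not truncate, see \<open>flength_fgcd_le\<close> below.\<close>

definition fdist :: "nat \<Rightarrow> (nat \<Rightarrow> nat) \<Rightarrow> (nat \<Rightarrow> nat) \<Rightarrow> nat" where
  "fdist k z z' = max (flength k z) (flength k z') - flength k (fgcd z z')"

definition is_chain ::
  "nat \<Rightarrow> nat \<Rightarrow> nat \<Rightarrow> nat \<Rightarrow> nat \<Rightarrow> (nat \<Rightarrow> nat) \<Rightarrow> (nat \<Rightarrow> nat) \<Rightarrow> (nat \<Rightarrow> nat) list \<Rightarrow> bool" where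
  "is_chain a d k m N z z' xs \<longleftrightarrow>
     xs \<noteq> [] \<and> hd xs = z \<and> last xs = z' \<and> set xs \<subseteq> factorizations a d k m \<and>
     successively (\<lambda>x y. fdist k x y \<le> N) xs"

definition monotone_lengths :: "nat \<Rightarrow> (nat \<Rightarrow> nat) list \<Rightarrow> bool" where
  "monotone_lengths k xs \<longleftrightarrow>
     successively (\<lambda>x y. flength k x \<le> flength k y) xs \<or>
     successively (\<lambda>x y. flength k x \<ge> flength k y) xs"

definition catenary_degree :: "nat \<Rightarrow> nat \<Rightarrow> nat \<Rightarrow> nat \<Rightarrow> nat" where
  "catenary_degree a d k m =
     (LEAST N. \<forall>z \<in> factorizations a d k m. \<forall>z' \<in> factorizations a d k m.
        \<exists>xs. is_chain a d k m N z z' xs)"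

definition monotone_catenary_degree :: "nat \<Rightarrow> nat \<Rightarrow> nat \<Rightarrow> nat \<Rightarrow> nat" where
  "monotone_catenary_degree a d k m =
     (LEAST N. \<forall>z \<in> factorizations a d k m. \<forall>z' \<in> factorizations a d k m.
        \<exists>xs. is_chain a d k m N z z' xs \<and> monotone_lengths k xs)"

text \<open>The maximum for the catenary degree exists by \<open>finite_catenary_degrees\<close> below.\<close>

definition monoid_catenary_degree :: "nat set \<Rightarrow> nat \<Rightarrow> nat \<Rightarrow> nat \<Rightarrow> nat" where
  "monoid_catenary_degree M a d k = Max {catenary_degree a d k m |m. m \<in> M}"

definition monoid_monotone_catenary_degree :: "nat set \<Rightarrow> nat \<Rightarrow> nat \<Rightarrow> nat \<Rightarrow> nat" where
  "monoid_monotone_catenary_degree M a d k = Max {monotone_catenary_degree a d k m |m. m \<in> M}"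


section \<open>Well-definedness\<close>

lemma flength_fgcd_le:
  "flength k (fgcd z z') \<le> flength k z" "flength k (fgcd z z') \<le> flength k z'"
  unfolding flength_def fgcd_def by (auto intro: sum_mono)

lemma flength_le:
  assumes "0 < a" "z \<in> factorizations a d k m"
  shows "flength k z \<le> m"
proof -
  have "flength k z \<le> (\<Sum>i\<le>k. z i * (a + i * d))"
    unfolding flength_def using assms(1) by (intro sum_mono) simp
  then show ?thesis using assms(2) by (simp add: factorizations_def)
qed

lemma fdist_le:
  assumes "0 < a" "z \<in> factorizations a d k m" "z' \<in> factorizations a d k m"
  shows "fdist k z z' \<le> m"
  using flength_le[OF assms(1,2)] flength_le[OF assms(1,3)] unfolding fdist_def by linarith

lemma fdist_commute: "fdist k z z' = fdist k z' z"
  by (simp add: fdist_def fgcd_def max.commute min.commute)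

lemma two_element_chain:
  assumes "z \<in> factorizations a d k m" "z' \<in> factorizations a d k m" "fdist k z z' \<le> N"
  shows "is_chain a d k m N z z' [z, z']" "monotone_lengths k [z, z']"
  using assms by (auto simp: is_chain_def monotone_lengths_def)

lemma catenary_degree_attained:
  assumes "0 < a" "z \<in> factorizations a d k m" "z' \<in> factorizations a d k m"
  shows "\<exists>xs. is_chain a d k m (catenary_degree a d k m) z z' xs"
proof -
  let ?P = "\<lambda>N. \<forall>z \<in> factorizations a d k m. \<forall>z' \<in> factorizations a d k m.
    \<exists>xs. is_chain a d k m N z z' xs"
  have "?P m"
    using two_element_chain(1) fdist_le[OF assms(1)] by blast
  then have "?P (catenary_degree a d k m)"
    unfolding catenary_degree_def by (rule LeastI)
  then show ?thesis using assms by blast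
qed

lemma monotone_catenary_degree_attained:
  assumes "0 < a" "z \<in> factorizations a d k m" "z' \<in> factorizations a d k m"
  shows "\<exists>xs. is_chain a d k m (monotone_catenary_degree a d k m) z z' xs \<and> monotone_lengths k xs"
proof -
  let ?P = "\<lambda>N. \<forall>z \<in> factorizations a d k m. \<forall>z' \<in> factorizations a d k m.
    \<exists>xs. is_chain a d k m N z z' xs \<and> monotone_lengths k xs"
  have "?P m"
    using two_element_chain fdist_le[OF assms(1)] by blast
  then have "?P (monotone_catenary_degree a d k m)"
    unfolding monotone_catenary_degree_def by (rule LeastI)
  then show ?thesis using assms by blast
qed

lemma chain_trans:
  assumes "is_chain a d k m N x y xs" "is_chain a d k m N y z ys"
  shows "is_chain a d k m N x z (xs @ ys)"
proof -
  have "fdist k y y \<le> N" by (simp add: fdist_def fgcd_def)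
  then show ?thesis
    using assms by (auto simp: is_chain_def successively_append_iff)
qed

lemma chain_rev:
  assumes "is_chain a d k m N x y xs"
  shows "is_chain a d k m N y x (rev xs)"
  using assms by (simp add: is_chain_def hd_rev last_rev fdist_commute)

lemma sum_increment:
  fixes f g :: "nat \<Rightarrow> nat"
  assumes "i \<le> k"
  shows "(\<Sum>j\<le>k. (f(i := f i + c)) j * g j) = (\<Sum>j\<le>k. f j * g j) + c * g i"
proof -
  have "(\<Sum>j\<le>k. (f(i := f i + c)) j * g j) = (\<Sum>j\<le>k. f j * g j + (if j = i then c * g i else 0))"
    by (intro sum.cong) (auto simp: algebra_simps)
  also have "\<dots> = (\<Sum>j\<le>k. f j * g j) + c * g i"
    using assms by (simp add: sum.distrib)
  finally show ?thesis .
qed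

lemma flength_increment:
  "i \<le> k \<Longrightarrow> flength k (f(i := f i + c)) = flength k f + c"
  using sum_increment[of i k f c "\<lambda>_. 1"] unfolding flength_def by simp

lemma fdist_increment:
  "fdist k (x(0 := x 0 + 1)) (y(0 := y 0 + 1)) = fdist k x y"
proof -
  have "fgcd (x(0 := x 0 + 1)) (y(0 := y 0 + 1)) = (fgcd x y)(0 := fgcd x y 0 + 1)"
    by (auto simp: fgcd_def)
  then show ?thesis by (simp only: fdist_def flength_increment[OF le0])
qed

lemma chain_increment:
  assumes "is_chain a d k m N x y xs"
  shows "is_chain a d k (m + a) N (x(0 := x 0 + 1)) (y(0 := y 0 + 1))
           (map (\<lambda>z. z(0 := z 0 + 1)) xs)"
proof -
  have "z(0 := z 0 + 1) \<in> factorizations a d k (m + a)" if "z \<in> factorizations a d k m" for z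
    using that sum_increment[of 0 k z 1 "\<lambda>i. a + i * d"] by (auto simp: factorizations_def)
  then show ?thesis
    using assms fdist_increment[of k]
    by (auto simp: is_chain_def hd_map last_map successively_map)
qed

lemma chain_to_positive:
  assumes a: "0 < a" and z: "z \<in> factorizations a d k m"
    and large: "(k + 1) * a * (a + k * d) < m" and N: "a + k * d \<le> N"
  shows "\<exists>w xs. 0 < w 0 \<and> w \<in> factorizations a d k m \<and> is_chain a d k m N z w xs"
proof (cases "0 < z 0")
  case True
  have "is_chain a d k m N z z [z]" using z by (simp add: is_chain_def)
  then show ?thesis using True z by blast
next
  case False
  have "\<exists>i\<le>k. a \<le> z i"
  proof (rule ccontr)
    assume "\<not> ?thesis"
    then have "z i * (a + i * d) \<le> a * (a + k * d)" if "i \<le> k" for i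
      using that by (intro mult_mono add_mono) (auto simp: not_le dest: spec[of _ i])
    then have "(\<Sum>i\<le>k. z i * (a + i * d)) \<le> (\<Sum>i\<le>k. a * (a + k * d))"
      by (intro sum_mono) simp
    also have "\<dots> = (k + 1) * a * (a + k * d)" by (simp add: algebra_simps)
    finally show False using z large by (simp add: factorizations_def)
  qed
  then obtain i where i: "i \<le> k" "a \<le> z i" by blast
  then have "i \<noteq> 0" using False a by (cases i) auto
  define y where "y = z(i := z i - a)"
  define w where "w = y(0 := y 0 + (a + i * d))"
  have zy: "z = y(i := y i + a)" using i by (auto simp: y_def)
  have w: "w \<in> factorizations a d k m"
  proof -
    have "\<forall>j>k. w j = 0" using z i by (auto simp: w_def y_def factorizations_def)
    moreover have "(\<Sum>j\<le>k. w j * (a + j * d)) = (\<Sum>j\<le>k. z j * (a + j * d))"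
      unfolding w_def
      by (subst zy, subst (1 2) sum_increment) (use i in \<open>auto simp: algebra_simps\<close>)
    ultimately show ?thesis using z by (simp add: factorizations_def)
  qed
  have "fgcd z w = y"
    using \<open>i \<noteq> 0\<close> by (auto simp: fgcd_def w_def y_def)
  moreover have "flength k z = flength k y + a"
    by (subst zy) (rule flength_increment[OF i(1)])
  moreover have "flength k w = flength k y + (a + i * d)"
    unfolding w_def by (rule flength_increment) simp
  ultimately have "fdist k z w \<le> a + i * d" by (simp add: fdist_def)
  also have "\<dots> \<le> N"
    using i(1) N mult_le_mono1[of i k d] by linarith
  finally have "is_chain a d k m N z w [z, w]"
    using two_element_chain(1) z w by blast
  moreover have "0 < w 0" using a by (simp add: w_def)
  ultimately show ?thesis using w by blast
qed

lemma bounded_chains: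
  assumes a: "0 < a" and "z \<in> factorizations a d k m" "z' \<in> factorizations a d k m"
  shows "\<exists>xs. is_chain a d k m ((k + 1) * a * (a + k * d)) z z' xs"
  using assms(2,3)
proof (induction m arbitrary: z z' rule: less_induct)
  case (less m)
  let ?B = "(k + 1) * a * (a + k * d)"
  show ?case
  proof (cases "m \<le> ?B")
    case True
    then have "fdist k z z' \<le> ?B" using fdist_le[OF a less.prems] by linarith
    then show ?thesis using two_element_chain(1) less.prems by blast
  next
    case False
    have "1 * (a + k * d) \<le> ?B" using a by (intro mult_le_mono1) simp
    then obtain w xs w' xs'
      where w: "0 < w 0" "w \<in> factorizations a d k m" "is_chain a d k m ?B z w xs"
        and w': "0 < w' 0" "w' \<in> factorizations a d k m" "is_chain a d k m ?B z' w' xs'"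
      using chain_to_positive[OF a _ _, of _ d k m ?B] less.prems False by (metis not_le mult_1)
    have dec: "u(0 := u 0 - 1) \<in> factorizations a d k (m - a) \<and> a \<le> m"
      if "0 < u 0" "u \<in> factorizations a d k m" for u
      using that sum_increment[of 0 k "u(0 := u 0 - 1)" 1 "\<lambda>i. a + i * d"]
      by (auto simp: factorizations_def)
    have "m - a < m" "a \<le> m" using a dec[OF w(1,2)] by auto
    then obtain ys where "is_chain a d k (m - a) ?B (w(0 := w 0 - 1)) (w'(0 := w' 0 - 1)) ys"
      using less.IH dec[OF w(1,2)] dec[OF w'(1,2)] by blast
    from chain_increment[OF this] obtain ys' where "is_chain a d k m ?B w w' ys'"
      using \<open>a \<le> m\<close> w(1) w'(1) by auto
    then show ?thesis
      using chain_trans[OF chain_trans[OF w(3)] chain_rev[OF w'(3)]] by blast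
  qed
qed

lemma finite_catenary_degrees:
  assumes "0 < a"
  shows "finite {catenary_degree a d k m |m. m \<in> M}"
proof (rule finite_subset)
  show "{catenary_degree a d k m |m. m \<in> M} \<subseteq> {..(k + 1) * a * (a + k * d)}"
    using bounded_chains[OF assms] by (auto simp: catenary_degree_def simp del: mult_Suc intro!: Least_le)
qed simp

end

theory Submission
  imports Defs "HOL-Library.Multiset"
begin

text \<open>
  Besides its length, a factorization \<open>z\<close> has a weight \<open>\<Sum>i. i * z i\<close>, and its value is
  \<open>a * length + d * weight\<close>. Hence for a fixed element \<open>m\<close> the length determines the weight, and a
  longer factorization has a smaller weight. Conversely, vectors of length \<open>l\<close> and weight \<open>w\<close> exist
  as soon as \<open>w \<le> k * l\<close>. This makes the set of lengths free of gaps in the following strong sense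
  (\<open>interpolate_length\<close>): if two factorizations \<open>x\<close> and \<open>y\<close> of \<open>m\<close> have the common part \<open>g\<close>, then
  every length of \<open>m\<close> between \<open>|x|\<close> and \<open>|y|\<close> is the length of some factorization of \<open>m\<close> that still
  contains \<open>g\<close>.

  Let \<open>N\<close> be such that any two factorizations of \<open>m\<close> are joined by an \<open>N\<close>-chain, and let
  \<open>|z| < |z'|\<close>. Some step \<open>x, y\<close> of an \<open>N\<close>-chain from \<open>z\<close> to \<open>z'\<close> leads from length at most \<open>|z|\<close>
  to length above \<open>|z|\<close>. Interpolation above the common part of \<open>x\<close> and \<open>y\<close> replaces it by a step
  \<open>u, v\<close> with \<open>|u| = |z|\<close> and \<open>|v| = min |y| |z'|\<close>; since \<open>u\<close> and \<open>v\<close> share at least \<open>g\<close> and \<open>v\<close> is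
  no longer than \<open>y\<close>, their distance is at most that of \<open>x\<close> and \<open>y\<close>. It remains to join \<open>z\<close> to \<open>u\<close>
  without changing the length, and to continue from \<open>v\<close> by induction (\<open>ex_monotone_path\<close>).

  Two factorizations of equal length also have equal weight, so they are multisets of indices with
  the same size and the same sum. Raising one index by 1 and lowering another one by 1 costs distance
  at most 2, and such exchanges join the two (\<open>equal_length_connected\<close>). Distance 2 is affordable:
  distinct factorizations are never closer than that (\<open>fdist_ge_2\<close>), so \<open>N \<ge> 2\<close> whenever there is
  anything to join.
\<close>

section \<open>Length and weight\<close>

definition fweight :: "nat \<Rightarrow> (nat \<Rightarrow> nat) \<Rightarrow> nat" where
  "fweight k z = (\<Sum>i\<le>k. z i * i)"

lemma sum_generators_eq_length_weight:
  "(\<Sum>i\<le>k. z i * (a + i * d)) = a * flength k z + d * fweight k z"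
  by (simp add: flength_def fweight_def sum_distrib_left algebra_simps sum.distrib)

lemma factorizations_iff:
  "z \<in> factorizations a d k m \<longleftrightarrow>
     (\<forall>i>k. z i = 0) \<and> a * flength k z + d * fweight k z = m"
  by (simp add: factorizations_def sum_generators_eq_length_weight)

lemma flength_add: "flength k (\<lambda>i. f i + g i) = flength k f + flength k g"
  by (simp add: flength_def sum.distrib)

lemma fweight_add: "fweight k (\<lambda>i. f i + g i) = fweight k f + fweight k g"
  by (simp add: fweight_def sum.distrib algebra_simps)

lemma fweight_increment:
  "i \<le> k \<Longrightarrow> fweight k (f(i := f i + c)) = fweight k f + c * i"
  using sum_increment[of i k f c "\<lambda>i. i"] unfolding fweight_def by simp

lemma flength_mono: "(\<And>i. g i \<le> x i) \<Longrightarrow> flength k g \<le> flength k x"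
  by (auto simp: flength_def intro: sum_mono)

lemma fdist_le_of_common_part:
  assumes "\<And>i. g i \<le> x i" "\<And>i. g i \<le> y i"
  shows "fdist k x y \<le> max (flength k x) (flength k y) - flength k g"
  using flength_mono[of g "fgcd x y" k] assms by (auto simp: fdist_def fgcd_def)

text \<open>Greedy choice: taking \<open>min k w\<close> as the next index leaves at most \<open>k\<close> times the remaining
  length.\<close>

lemma ex_vector_of_length_weight:
  assumes "w \<le> k * l"
  shows "\<exists>f. (\<forall>i>k. f i = 0) \<and> flength k f = l \<and> fweight k f = w"
  using assms
proof (induction l arbitrary: w)
  case 0
  then show ?case by (intro exI[of _ "\<lambda>_. 0"]) (simp add: flength_def fweight_def)
next
  case (Suc l)
  let ?i = "min k w"
  have "w - ?i \<le> k * l" using Suc.prems by auto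
  from Suc.IH[OF this] obtain f
    where f: "\<forall>i>k. f i = 0" "flength k f = l" "fweight k f = w - ?i" by blast
  let ?f = "f(?i := f ?i + 1)"
  have "\<forall>i>k. ?f i = 0" using f(1) by auto
  moreover have "flength k ?f = Suc l"
    using flength_increment[of ?i k f 1] f(2) by simp
  moreover have "fweight k ?f = w"
    using fweight_increment[of ?i k f 1] f(3) by simp
  ultimately show ?case by blast
qed


section \<open>Interpolating lengths above a common part\<close>

lemma fweight_antimono_flength:
  assumes "0 < d" "z \<in> factorizations a d k m" "z' \<in> factorizations a d k m"
    and "flength k z \<le> flength k z'"
  shows "fweight k z' \<le> fweight k z"
proof -
  have "a * flength k z + d * fweight k z = a * flength k z' + d * fweight k z'"
    using assms(2,3) by (simp add: factorizations_iff)
  moreover have "a * flength k z \<le> a * flength k z'" using assms(4) by simp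
  ultimately have "d * fweight k z' \<le> d * fweight k z" by linarith
  then show ?thesis using assms(1) by simp
qed

text \<open>The wanted vector is the common part \<open>g\<close> plus some \<open>f\<close> whose length and weight are those of \<open>t\<close>
  minus those of \<open>g\<close>. Such an \<open>f\<close> exists because \<open>t\<close> lies between \<open>x\<close> and \<open>y\<close>: the weight of \<open>t\<close> is
  at least that of \<open>y\<close>, hence at least that of \<open>g\<close>, so the difference is not negative; and it is at
  most that of \<open>x\<close>, where the part beyond \<open>g\<close> has weight at most \<open>k * (|x| - |g|) \<le> k * (|t| - |g|)\<close>.\<close>

lemma interpolate_length:
  assumes d: "0 < d"
    and x: "x \<in> factorizations a d k m" and y: "y \<in> factorizations a d k m"
    and t: "t \<in> factorizations a d k m"
    and len: "flength k x \<le> flength k t" "flength k t \<le> flength k y"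
  shows "\<exists>u \<in> factorizations a d k m. flength k u = flength k t \<and> (\<forall>i. fgcd x y i \<le> u i)"
proof -
  let ?g = "fgcd x y"
  have wxt: "fweight k t \<le> fweight k x" by (rule fweight_antimono_flength[OF d x t len(1)])
  have wty: "fweight k y \<le> fweight k t" by (rule fweight_antimono_flength[OF d t y len(2)])
  have wgy: "fweight k ?g \<le> fweight k y"
    by (auto simp: fweight_def fgcd_def intro!: sum_mono)
  have lgx: "flength k ?g \<le> flength k x" by (rule flength_fgcd_le)
  \<comment> \<open>Every index is at most \<open>k\<close>; subtraction-free form of
    \<open>weight x - weight g \<le> k * (|x| - |g|)\<close>.\<close>
  have "fweight k x + k * flength k ?g \<le> fweight k ?g + k * flength k x"
  proof -
    have "x i * i + k * ?g i \<le> ?g i * i + k * x i" if "i \<le> k" for i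
    proof -
      obtain c where c: "x i = ?g i + c"
        using le_Suc_ex[of "?g i" "x i"] by (auto simp: fgcd_def)
      have "c * i \<le> k * c" using that by simp
      then show ?thesis unfolding c by (simp add: algebra_simps)
    qed
    then have "(\<Sum>i\<le>k. x i * i + k * ?g i) \<le> (\<Sum>i\<le>k. ?g i * i + k * x i)"
      by (intro sum_mono) simp
    then show ?thesis
      by (simp add: fweight_def flength_def sum.distrib sum_distrib_left)
  qed
  moreover have "k * flength k x \<le> k * flength k t" using len(1) by simp
  ultimately have "fweight k t - fweight k ?g \<le> k * (flength k t - flength k ?g)"
    using wxt unfolding diff_mult_distrib2 by linarith
  then obtain f where f: "\<forall>i>k. f i = 0" "flength k f = flength k t - flength k ?g"
      "fweight k f = fweight k t - fweight k ?g"
    using ex_vector_of_length_weight by blast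
  let ?u = "\<lambda>i. ?g i + f i"
  have "flength k ?u = flength k t" using f(2) lgx len(1) by (simp add: flength_add)
  moreover have "fweight k ?u = fweight k t" using f(3) wgy wty by (simp add: fweight_add)
  moreover have "\<forall>i>k. ?u i = 0" using f(1) x by (simp add: fgcd_def factorizations_def)
  ultimately show ?thesis using t by (intro bexI[of _ ?u]) (auto simp: factorizations_iff)
qed


section \<open>Factorizations of equal length\<close>

text \<open>Chains are handled through the reflexive transitive closure of this relation, which is easier to
  compose than lists; \<open>chain_of_monotone_path\<close> translates back.\<close>

definition increasing_step ::
  "nat \<Rightarrow> nat \<Rightarrow> nat \<Rightarrow> nat \<Rightarrow> nat \<Rightarrow> (nat \<Rightarrow> nat) \<Rightarrow> (nat \<Rightarrow> nat) \<Rightarrow> bool" where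
  "increasing_step a d k m N x y \<longleftrightarrow>
     x \<in> factorizations a d k m \<and> y \<in> factorizations a d k m \<and>
     fdist k x y \<le> N \<and> flength k x \<le> flength k y"

lemma flength_fweight_count:
  assumes "set_mset A \<subseteq> {..k}"
  shows "flength k (count A) = size A" "fweight k (count A) = sum_mset A"
  using assms
proof (induction A)
  case empty
  { case 1 show ?case by (simp add: flength_def) }
  { case 2 show ?case by (simp add: fweight_def) }
next
  case (add i A)
  have upd: "count (add_mset i A) = (count A)(i := count A i + 1)" by auto
  { case 1 then show ?case
      using add.IH(1) flength_increment[of i k "count A" 1] unfolding upd by (simp del: fun_upd_apply) }
  { case 2 then show ?case
      using add.IH(2) fweight_increment[of i k "count A" 1] unfolding upd by (simp del: fun_upd_apply) }
qed

lemma ex_list_of_vector: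
  fixes z :: "nat \<Rightarrow> nat"
  assumes "\<forall>i>k. z i = 0"
  shows "\<exists>xs. set xs \<subseteq> {..k} \<and> count (mset xs) = z"
proof -
  have "{i. z i > 0} \<subseteq> {..k}" using assms by (auto intro: leI)
  then have "finite {i. z i > 0}" by (rule finite_subset) simp
  then have c: "count (Abs_multiset z) = z" by (rule count_Abs_multiset)
  obtain xs where xs: "mset xs = Abs_multiset z" using ex_mset by blast
  have "i \<le> k" if "i \<in> set xs" for i
  proof (rule ccontr)
    assume "\<not> i \<le> k"
    then have "count (mset xs) i = 0" using assms c xs by simp
    then show False using that by (simp add: count_eq_zero_iff)
  qed
  then show ?thesis using c xs by (intro exI[of _ xs]) auto
qed

text \<open>An exchange keeps all but two of the entries, so the two multisets have a common part of size
  \<open>length xs - 2\<close>; that bounds the distance by 2.\<close>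

lemma list_exchange_step:
  fixes xs :: "nat list"
  assumes xs: "set xs \<subseteq> {..k}" and pq: "p < length xs" "q < length xs" "p \<noteq> q"
    and room: "xs ! p < k" "0 < xs ! q"
    and fact: "count (mset xs) \<in> factorizations a d k m" and N: "2 \<le> N"
    and xs': "xs' = xs[p := xs ! p + 1, q := xs ! q - 1]"
  shows "set xs' \<subseteq> {..k}" "increasing_step a d k m N (count (mset xs)) (count (mset xs'))"
proof -
  have "xs ! q \<le> k" using xs nth_mem[OF pq(2)] by auto
  then have "{xs ! p + 1, xs ! q - 1} \<subseteq> {..k}" using room by auto
  then show sub: "set xs' \<subseteq> {..k}"
    using xs set_update_subset_insert[of "xs[p := xs ! p + 1]" q "xs ! q - 1"]
      set_update_subset_insert[of xs p "xs ! p + 1"] unfolding xs' by blast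
  have len: "length xs' = length xs" by (simp add: xs')
  let ?C = "mset xs - {#xs ! p#} - {#xs ! q#}"
  have in1: "xs ! p \<in># mset xs" using pq by simp
  have in2: "xs ! q \<in># mset xs - {#xs ! p#}"
  proof -
    \<comment> \<open>If \<open>xs ! p = xs ! q\<close>, the occurrence at \<open>q\<close> must survive the removal of the one at \<open>p\<close>.
      Overwriting position \<open>p\<close> by 0 keeps position \<open>q\<close>, whose entry is positive.\<close>
    have "mset (xs[p := 0]) = add_mset 0 (mset xs - {#xs ! p#})"
      using pq by (simp add: mset_update)
    moreover have "xs ! q \<in> set (xs[p := 0])"
      using pq by (metis length_list_update nth_list_update_neq nth_mem)
    ultimately have "xs ! q \<in># add_mset 0 (mset xs - {#xs ! p#})" by (metis set_mset_mset)
    then show ?thesis using room by simp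
  qed
  have m1: "mset xs = add_mset (xs ! p) (add_mset (xs ! q) ?C)"
    using in1 in2 by (metis insert_DiffM)
  have m2: "mset xs' = add_mset (xs ! p + 1) (add_mset (xs ! q - 1) ?C)"
  proof -
    have "mset xs' = add_mset (xs ! q - 1) (mset (xs[p := xs ! p + 1]) - {#xs ! q#})"
      using pq by (simp add: xs' mset_update)
    also have "mset (xs[p := xs ! p + 1]) = add_mset (xs ! p + 1) (mset xs - {#xs ! p#})"
      using pq by (simp add: mset_update)
    also have "\<dots> - {#xs ! q#} = add_mset (xs ! p + 1) ?C"
      using in2 by simp
    finally show ?thesis by (simp add: add_mset_commute)
  qed
  have C: "set_mset ?C \<subseteq> {..k}" using xs by (auto dest!: in_diffD)
  have "flength k (count (mset xs)) = length xs" "flength k (count (mset xs')) = length xs"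
    using flength_fweight_count(1)[of "mset xs" k] flength_fweight_count(1)[of "mset xs'" k]
      xs sub len by simp_all
  moreover have "flength k (count ?C) = length xs - 2"
    using flength_fweight_count(1)[OF C] arg_cong[OF m1, of size] by simp
  moreover have "fdist k (count (mset xs)) (count (mset xs')) \<le>
      max (flength k (count (mset xs))) (flength k (count (mset xs'))) - flength k (count ?C)"
    by (rule fdist_le_of_common_part) (simp_all only: m2, subst m1, simp_all)
  ultimately have "fdist k (count (mset xs)) (count (mset xs')) \<le> N"
    and eqlen: "flength k (count (mset xs)) = flength k (count (mset xs'))"
    using N by linarith+
  moreover have "count (mset xs') \<in> factorizations a d k m"
  proof -
    have "sum_mset (mset xs') = sum_mset (mset xs)"
      unfolding m2 by (subst m1) (use room in simp)
    then have "fweight k (count (mset xs')) = fweight k (count (mset xs))"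
      using flength_fweight_count(2)[of "mset xs" k] flength_fweight_count(2)[of "mset xs'" k]
        xs sub by simp
    moreover have "\<forall>i>k. count (mset xs') i = 0"
      using sub by (auto simp: count_eq_zero_iff)
    ultimately show ?thesis using fact eqlen by (simp add: factorizations_iff)
  qed
  ultimately show "increasing_step a d k m N (count (mset xs)) (count (mset xs'))"
    using fact by (simp add: increasing_step_def)
qed

text \<open>Ordering the entries of a factorization, in any way, turns the problem into moving a sequence
  in \<open>{..k}\<close> towards another one with the same sum. As the sums agree, some entry is too
  small whenever some entry is too large; exchanging one unit between the two lowers the
  sum of the absolute differences and keeps every entry between the old one and its target, thus
  within \<open>{..k}\<close>.\<close>

lemma lists_connected:
  fixes xs ys :: "nat list"
  assumes "set xs \<subseteq> {..k}" "set ys \<subseteq> {..k}" "length xs = length ys"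
    and "sum_list xs = sum_list ys"
    and "count (mset xs) \<in> factorizations a d k m" "2 \<le> N"
  shows "(increasing_step a d k m N)\<^sup>*\<^sup>* (count (mset xs)) (count (mset ys))"
  using assms
proof (induction "\<Sum>i<length ys. (xs ! i - ys ! i) + (ys ! i - xs ! i)" arbitrary: xs
    rule: less_induct)
  case less
  show ?case
  proof (cases "xs = ys")
    case True
    then show ?thesis by simp
  next
    case False
    have sums: "(\<Sum>i<length ys. xs ! i) = (\<Sum>i<length ys. ys ! i)"
      using less.prems(3,4) by (simp add: sum_list_sum_nth atLeast0LessThan)
    have neq: "\<exists>i<length ys. xs ! i \<noteq> ys ! i"
      using False less.prems(3) by (auto simp: list_eq_iff_nth_eq)
    have "\<exists>p<length ys. xs ! p < ys ! p"
    proof (rule ccontr)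
      assume none: "\<not> ?thesis"
      have le: "ys ! i \<le> xs ! i" if "i < length ys" for i using that none by (meson not_le)
      moreover obtain i where "i < length ys" "ys ! i < xs ! i"
        using neq le by (metis le_neq_implies_less)
      ultimately have "(\<Sum>i<length ys. ys ! i) < (\<Sum>i<length ys. xs ! i)"
        by (intro sum_strict_mono_ex1) auto
      then show False using sums by simp
    qed
    then obtain p where p: "p < length ys" "xs ! p < ys ! p" by blast
    have "\<exists>q<length ys. ys ! q < xs ! q"
    proof (rule ccontr)
      assume none: "\<not> ?thesis"
      have "xs ! i \<le> ys ! i" if "i < length ys" for i using that none by (meson not_le)
      then have "(\<Sum>i<length ys. xs ! i) < (\<Sum>i<length ys. ys ! i)"
        using p by (intro sum_strict_mono_ex1) auto
      then show False using sums by simp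
    qed
    then obtain q where q: "q < length ys" "ys ! q < xs ! q" by blast
    have pq: "p \<noteq> q" using p q by auto
    define xs' where "xs' = xs[p := xs ! p + 1, q := xs ! q - 1]"
    have "ys ! p \<le> k" using less.prems(2) p by (auto simp: subset_iff)
    then have "xs ! p < k" using p by simp
    note step = list_exchange_step[OF less.prems(1) _ _ pq this _ less.prems(5,6) xs'_def]
    have s1: "set xs' \<subseteq> {..k}"
      and s2: "increasing_step a d k m N (count (mset xs)) (count (mset xs'))"
      using step p q less.prems(3) by auto
    have nth: "xs' ! i = (if i = q then xs ! q - 1 else if i = p then xs ! p + 1 else xs ! i)"
      if "i < length ys" for i
      using that pq less.prems(3) by (auto simp: xs'_def nth_list_update)
    have len: "length xs' = length ys" using less.prems(3) by (simp add: xs'_def)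
    have fact: "count (mset xs') \<in> factorizations a d k m"
      using s2 by (simp add: increasing_step_def)
    have "sum_list xs' + (xs ! p + xs ! q) = sum_list xs + (xs' ! p + xs' ! q)"
    proof -
      have "sum_list l = (l ! p + l ! q) + (\<Sum>i\<in>{..<length ys} - {p, q}. l ! i)"
        if "length l = length ys" for l :: "nat list"
        using sum.subset_diff[of "{p, q}" "{..<length ys}" "\<lambda>i. l ! i"] p q pq that
        by (simp add: sum_list_sum_nth atLeast0LessThan)
      moreover have "(\<Sum>i\<in>{..<length ys} - {p, q}. xs' ! i) = (\<Sum>i\<in>{..<length ys} - {p, q}. xs ! i)"
        by (rule sum.cong) (auto simp: nth)
      ultimately show ?thesis using len less.prems(3) by simp
    qed
    then have sum: "sum_list xs' = sum_list ys"
      using nth[OF p(1)] nth[OF q(1)] pq q less.prems(4) by simp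
    have "(\<Sum>i<length ys. (xs' ! i - ys ! i) + (ys ! i - xs' ! i))
        < (\<Sum>i<length ys. (xs ! i - ys ! i) + (ys ! i - xs ! i))"
      by (rule sum_strict_mono_ex1) (use nth p q pq in auto)
    from less.hyps[OF this s1 less.prems(2) len sum fact less.prems(6)]
    show ?thesis by (rule converse_rtranclp_into_rtranclp[of "increasing_step a d k m N", OF s2])
  qed
qed

lemma equal_length_connected:
  assumes d: "0 < d" and N: "2 \<le> N"
    and z: "z \<in> factorizations a d k m" and z': "z' \<in> factorizations a d k m"
    and len: "flength k z = flength k z'"
  shows "(increasing_step a d k m N)\<^sup>*\<^sup>* z z'"
proof -
  obtain xs ys where xs: "set xs \<subseteq> {..k}" "count (mset xs) = z"
    and ys: "set ys \<subseteq> {..k}" "count (mset ys) = z'"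
    using ex_list_of_vector[of k z] ex_list_of_vector[of k z'] z z'
    by (auto simp: factorizations_def)
  have "fweight k z = fweight k z'"
    using z z' len d by (auto simp: factorizations_iff)
  then have "sum_list xs = sum_list ys"
    using flength_fweight_count(2)[of "mset xs" k] flength_fweight_count(2)[of "mset ys" k] xs ys
    by (simp add: sum_mset_sum_list)
  moreover have "length xs = length ys"
    using flength_fweight_count(1)[of "mset xs" k] flength_fweight_count(1)[of "mset ys" k] xs ys len
    by simp
  ultimately show ?thesis
    using lists_connected[OF xs(1) ys(1), of a d m N] xs(2) ys(2) z N by simp
qed


section \<open>Monotone chains from arbitrary chains\<close>

text \<open>Generators are positive, so a factorization cannot be strictly contained in another one of the
  same element.\<close>

lemma not_pointwise_le:
  assumes "0 < a" "x \<in> factorizations a d k m" "y \<in> factorizations a d k m" "x \<noteq> y"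
  shows "\<exists>i\<le>k. x i < y i"
proof (rule ccontr)
  assume "\<not> ?thesis"
  then have le: "y i \<le> x i" if "i \<le> k" for i using that by (meson not_le)
  obtain i where i: "x i \<noteq> y i" using assms(4) by blast
  then have ik: "i \<le> k" using assms(2,3) by (metis (mono_tags, lifting) factorizations_iff not_le)
  have "y i < x i" using le[OF ik] i by simp
  then have "(\<Sum>i\<le>k. y i * (a + i * d)) < (\<Sum>i\<le>k. x i * (a + i * d))"
    using le ik assms(1) by (intro sum_strict_mono_ex1 ballI bexI[of _ i] mult_le_mono1) auto
  then show False using assms(2,3) by (simp add: factorizations_def)
qed

text \<open>At distance at most 1, \<open>x\<close> and \<open>y\<close> exceed their common part by at most one generator each. Both
  exceed it by exactly one, since neither contains the other, and then the two generators must be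
  equal.\<close>

lemma fdist_ge_2:
  assumes a: "0 < a" and d: "0 < d"
    and x: "x \<in> factorizations a d k m" and y: "y \<in> factorizations a d k m" and "x \<noteq> y"
  shows "2 \<le> fdist k x y"
proof (rule ccontr)
  assume "\<not> ?thesis"
  then have short: "flength k x \<le> flength k (fgcd x y) + 1" "flength k y \<le> flength k (fgcd x y) + 1"
    by (auto simp: fdist_def)
  let ?g = "fgcd x y"
  \<comment> \<open>Applied to \<open>u = x\<close> and \<open>u = y\<close>.\<close>
  have eq: "u = ?g(i := ?g i + 1)"
    if i: "i \<le> k" "?g i < u i" and le: "\<And>j. ?g j \<le> u j"
      and u: "flength k u \<le> flength k ?g + 1" "\<forall>j>k. u j = 0" for u i
  proof (rule ccontr)
    let ?h = "?g(i := ?g i + 1)"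
    assume "u \<noteq> ?h"
    then obtain j where j: "u j \<noteq> ?h j" by blast
    have hle: "?h l \<le> u l" for l using i le[of l] by auto
    have "j \<le> k" using j u(2) hle[of j] by (metis le_zero_eq not_le)
    have "?h j < u j" using hle[of j] j by linarith
    then have "flength k ?h < flength k u"
      unfolding flength_def using hle \<open>j \<le> k\<close>
      by (intro sum_strict_mono_ex1 ballI bexI[of _ j]) (simp_all del: fun_upd_apply)
    then show False using flength_increment[OF i(1), of ?g 1] u(1) by simp
  qed
  obtain i where i: "i \<le> k" "y i < x i" using not_pointwise_le[OF a y x] \<open>x \<noteq> y\<close> by auto
  obtain j where j: "j \<le> k" "x j < y j" using not_pointwise_le[OF a x y] \<open>x \<noteq> y\<close> by auto
  have x': "x = ?g(i := ?g i + 1)"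
    by (rule eq) (use i x short in \<open>auto simp: fgcd_def factorizations_def\<close>)
  have y': "y = ?g(j := ?g j + 1)"
    by (rule eq) (use j y short in \<open>auto simp: fgcd_def factorizations_def\<close>)
  have "flength k x = flength k ?g + 1" "fweight k x = fweight k ?g + i"
    "flength k y = flength k ?g + 1" "fweight k y = fweight k ?g + j"
    using flength_increment[OF i(1), of ?g 1] fweight_increment[OF i(1), of ?g 1]
      flength_increment[OF j(1), of ?g 1] fweight_increment[OF j(1), of ?g 1]
    unfolding x'[symmetric] y'[symmetric] by simp_all
  then have "i = j" using x y d by (auto simp: factorizations_iff)
  then show False using i(2) j(2) by simp
qed

lemma successively_crossing:
  assumes "successively R xs" "xs \<noteq> []" "P (hd xs)" "\<not> P (last xs)"
  shows "\<exists>x\<in>set xs. \<exists>y\<in>set xs. R x y \<and> P x \<and> \<not> P y"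
  using assms
proof (induction xs)
  case (Cons x xs)
  show ?case
  proof (cases "xs \<noteq> [] \<and> P (hd xs)")
    case True
    then show ?thesis using Cons by (auto simp: successively_Cons)
  next
    case False
    then have "xs \<noteq> []" "\<not> P (hd xs)" using Cons.prems by auto
    then show ?thesis using Cons.prems by (auto simp: successively_Cons)
  qed
qed simp

lemma chain_bound_ge_2:
  assumes "0 < a" "0 < d" "is_chain a d k m N z z' xs" "z \<noteq> z'"
  shows "2 \<le> N"
proof -
  obtain x y where "x \<in> set xs" "y \<in> set xs" "fdist k x y \<le> N" "x \<noteq> y"
    using successively_crossing[of "\<lambda>x y. fdist k x y \<le> N" xs "\<lambda>x. x = z"] assms(3,4)
    by (auto simp: is_chain_def)
  moreover have "set xs \<subseteq> factorizations a d k m" using assms(3) by (simp add: is_chain_def)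
  ultimately have "2 \<le> fdist k x y" using fdist_ge_2[OF assms(1,2), of x k m y] by blast
  then show ?thesis using \<open>fdist k x y \<le> N\<close> by simp
qed

text \<open>The induction is on the length still to be gained. The bound \<open>N\<close> for arbitrary chains is assumed
  for all pairs because the induction restarts from a new factorization \<open>v\<close>.\<close>

lemma ex_monotone_path:
  assumes a: "0 < a" and d: "0 < d"
    and conn: "\<And>z z'. z \<in> factorizations a d k m \<Longrightarrow> z' \<in> factorizations a d k m \<Longrightarrow>
                 \<exists>xs. is_chain a d k m N z z' xs"
    and "z \<in> factorizations a d k m" "z' \<in> factorizations a d k m"
    and "flength k z \<le> flength k z'"
  shows "(increasing_step a d k m N)\<^sup>*\<^sup>* z z'"
  using assms(4-)
proof (induction "flength k z' - flength k z" arbitrary: z rule: less_induct)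
  case less
  note z = less.prems(1) and z' = less.prems(2)
  show ?case
  proof (cases "z = z'")
    case False
    obtain xs where xs: "is_chain a d k m N z z' xs" using conn z z' by blast
    have N: "2 \<le> N" using chain_bound_ge_2[OF a d xs False] .
    show ?thesis
    proof (cases "flength k z = flength k z'")
      case True
      then show ?thesis using equal_length_connected[OF d N z z'] by blast
    next
      case False
      then have lt: "flength k z < flength k z'" using less.prems(3) by simp
      obtain x y where xy: "x \<in> factorizations a d k m" "y \<in> factorizations a d k m"
          "fdist k x y \<le> N" "flength k x \<le> flength k z" "flength k z < flength k y"
        using successively_crossing[of "\<lambda>x y. fdist k x y \<le> N" xs "\<lambda>x. flength k x \<le> flength k z"]
          xs lt by (auto simp: is_chain_def not_le)
      \<comment> \<open>The step may overshoot \<open>|z'|\<close>, and \<open>t\<close> cuts it off there.\<close>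
      define t where "t = (if flength k y \<le> flength k z' then y else z')"
      have t: "t \<in> factorizations a d k m" "flength k z < flength k t"
          "flength k t \<le> flength k y" "flength k t \<le> flength k z'"
        using xy z' lt by (auto simp: t_def)
      obtain u where u: "u \<in> factorizations a d k m" "flength k u = flength k z"
          "\<forall>i. fgcd x y i \<le> u i"
        using interpolate_length[OF d xy(1,2) z] xy(4,5) by auto
      obtain v where v: "v \<in> factorizations a d k m" "flength k v = flength k t"
          "\<forall>i. fgcd x y i \<le> v i"
        using interpolate_length[OF d xy(1,2) t(1)] xy(4) t by auto
      have "fdist k u v \<le> max (flength k u) (flength k v) - flength k (fgcd x y)"
        using fdist_le_of_common_part u(3) v(3) by blast
      also have "\<dots> \<le> fdist k x y"
        using u(2) v(2) t xy(4,5) by (simp add: fdist_def)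
      finally have "increasing_step a d k m N u v"
        using u v xy(3) t(2) by (simp add: increasing_step_def)
      moreover have "(increasing_step a d k m N)\<^sup>*\<^sup>* z u"
        using equal_length_connected[OF d N z u(1)] u(2) by simp
      moreover have "(increasing_step a d k m N)\<^sup>*\<^sup>* v z'"
        using less.hyps[of v] v z' t lt by simp
      ultimately show ?thesis by simp
    qed
  qed simp
qed

lemma chain_of_monotone_path:
  assumes "(increasing_step a d k m N)\<^sup>*\<^sup>* z z'" "z' \<in> factorizations a d k m"
  shows "\<exists>xs. is_chain a d k m N z z' xs \<and> successively (\<lambda>x y. flength k x \<le> flength k y) xs"
  using assms
proof (induction rule: converse_rtranclp_induct)
  case base
  then show ?case by (intro exI[of _ "[z']"]) (simp add: is_chain_def)
next
  case (step x y)
  then obtain xs where "is_chain a d k m N y z' xs"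
    "successively (\<lambda>x y. flength k x \<le> flength k y) xs" by blast
  then show ?case using step.hyps(1)
    by (intro exI[of _ "x # xs"]) (auto simp: is_chain_def increasing_step_def successively_Cons)
qed

lemma ex_monotone_chain:
  assumes "0 < a" "0 < d"
    and conn: "\<And>z z'. z \<in> factorizations a d k m \<Longrightarrow> z' \<in> factorizations a d k m \<Longrightarrow>
                 \<exists>xs. is_chain a d k m N z z' xs"
    and z: "z \<in> factorizations a d k m" and z': "z' \<in> factorizations a d k m"
  shows "\<exists>xs. is_chain a d k m N z z' xs \<and> monotone_lengths k xs"
proof (cases "flength k z \<le> flength k z'")
  case True
  show ?thesis
    using chain_of_monotone_path[OF ex_monotone_path[OF assms(1,2) conn z z' True] z']
    by (auto simp: monotone_lengths_def)
next
  case False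
  then have "flength k z' \<le> flength k z" by simp
  from chain_of_monotone_path[OF ex_monotone_path[OF assms(1,2) conn z' z this] z]
  obtain xs where xs: "is_chain a d k m N z' z xs"
    "successively (\<lambda>x y. flength k x \<le> flength k y) xs" by blast
  have "monotone_lengths k (rev xs)" using xs(2) by (simp add: monotone_lengths_def)
  then show ?thesis by (intro exI conjI) (rule chain_rev[OF xs(1)])
qed

lemma monotone_catenary_degree_eq:
  assumes "0 < a" "0 < d"
  shows "monotone_catenary_degree a d k m = catenary_degree a d k m"
proof (rule antisym)
  show "monotone_catenary_degree a d k m \<le> catenary_degree a d k m"
    unfolding monotone_catenary_degree_def
  proof (intro Least_le ballI)
    fix z z'
    assume "z \<in> factorizations a d k m" "z' \<in> factorizations a d k m"
    with catenary_degree_attained[OF assms(1)]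
    show "\<exists>xs. is_chain a d k m (catenary_degree a d k m) z z' xs \<and> monotone_lengths k xs"
      by (rule ex_monotone_chain[OF assms])
  qed
  show "catenary_degree a d k m \<le> monotone_catenary_degree a d k m"
    unfolding catenary_degree_def
  proof (intro Least_le ballI)
    fix z z'
    assume "z \<in> factorizations a d k m" "z' \<in> factorizations a d k m"
    from monotone_catenary_degree_attained[OF assms(1) this]
    show "\<exists>xs. is_chain a d k m (monotone_catenary_degree a d k m) z z' xs" by blast
  qed
qed

theorem theorem6:
  fixes M :: "nat set" and a d k :: nat
  assumes "arithmetic_monoid M a d k"
  shows "(\<forall>m\<in>M. monotone_catenary_degree a d k m = catenary_degree a d k m) \<and>
         monoid_monotone_catenary_degree M a d k = monoid_catenary_degree M a d k"
proof -
  have "0 < a" "0 < d" using assms unfolding arithmetic_monoid_def by blast+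
  note eq = monotone_catenary_degree_eq[OF this]
  then show ?thesis
    by (simp add: monoid_monotone_catenary_degree_def monoid_catenary_degree_def)
qed

end
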